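(* Let $G\curvearrowright X$ be a group action. (1) Let $H\le G$ be a finite index subgroup and $H\curvearrowright X$ the action of $G$ restricted to $H$. Then $$\mathcal T(H\curvearrowright X)-2\le [G:H]\,(\mathcal T(G\curvearrowright X)-2).$$ (2) If $G\curvearrowright X$ has amenable point stabilizers, then $\mathcal T(G\curvearrowright X)=\mathcal T(G)$.
   Context: All groups act from the right, on nonempty sets. A group action $G\curvearrowright X$ admits a paradoxical decomposition if there exist positive integers $m,n$, (pairwise) disjoint subsets $P_1,\dots,P_m,Q_1,\dots,Q_n$ of $X$ and subsets $S_1=\{g_1,\dots,g_m\}$, $S_2=\{h_1,\dots,h_n\}$ of $G$ such that $X=\bigcup_{i=1}^m P_ig_i=\bigcup_{j=1}^n Q_jh_j$. The Tarski number $\mathcal T(G\curvearrowright X)$ is the minimal possible value of $m+n$ over all paradoxical decompositions of the action (and $\infty$ if there is none). $\mathcal T(G)$ denotes the Tarski number of the action of $G$ on itself by right multiplication. Groups are regarded as discrete groups when speaking of amenability. *)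

theory Defs
  imports Complex_Main "HOL-Algebra.Group_Action" "HOL-Library.Extended_Nat"
    "HOL-Library.Disjoint_Sets"
begin

text \<open>
  The action map is written \<open>act x g\<close> for \<open>x \<cdot> g\<close>. The locale \<open>group_action\<close> of HOL-Algebra
  describes left actions, so right actions get their own locale; lemma \<open>left_action\<close> below
  gives the usual translation.
\<close>

locale right_group_action = group G for G (structure) +
  fixes X :: "'x set" and act :: "'x \<Rightarrow> 'a \<Rightarrow> 'x"
  assumes nonempty: "X \<noteq> {}"
    and act_closed: "\<lbrakk>x \<in> X; g \<in> carrier G\<rbrakk> \<Longrightarrow> act x g \<in> X"
    and act_one: "x \<in> X \<Longrightarrow> act x \<one> = x"
    and act_mult: "\<lbrakk>x \<in> X; g \<in> carrier G; h \<in> carrier G\<rbrakk> \<Longrightarrow> act x (g \<otimes> h) = act (act x g) h"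

lemma (in group) right_regular_action: "right_group_action G (carrier G) (\<otimes>)"
  by unfold_locales (auto simp: m_assoc)

lemma (in right_group_action) restrict_subgroup:
  assumes "subgroup H G"
  shows "right_group_action (G\<lparr>carrier := H\<rparr>) X act"
proof -
  interpret H: group "G\<lparr>carrier := H\<rparr>"
    using assms by (rule subgroup.subgroup_is_group[OF _ is_group])
  show ?thesis
    using nonempty act_closed act_one act_mult subgroup.mem_carrier[OF assms]
    by unfold_locales auto
qed

lemma (in right_group_action) left_action:
  "group_action G X (\<lambda>g. \<lambda>x\<in>X. act x (inv g))"
proof -
  have cancel: "act (act x g) (inv g) = x" "act (act x (inv g)) g = x"
    if "x \<in> X" "g \<in> carrier G" for x g
    using that act_mult[of x g "inv g"] act_mult[of x "inv g" g] act_one by auto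
  have bij: "bij_betw (\<lambda>x\<in>X. act x (inv g)) X X" if "g \<in> carrier G" for g
    by (rule bij_betw_byWitness[where f' = "\<lambda>x. act x g"])
       (use that cancel act_closed in auto)
  have Bij: "(\<lambda>x\<in>X. act x (inv g)) \<in> Bij X" if "g \<in> carrier G" for g
    using bij[OF that] unfolding Bij_def by blast
  have hom: "(\<lambda>x\<in>X. act x (inv (g \<otimes> h))) =
      compose X (\<lambda>x\<in>X. act x (inv g)) (\<lambda>x\<in>X. act x (inv h))"
    if "g \<in> carrier G" "h \<in> carrier G" for g h
    using that by (auto simp: compose_def fun_eq_iff inv_mult_group act_mult act_closed)
  show ?thesis
    unfolding group_action_def
    by (rule group_hom.intro[OF is_group group_BijGroup])
       (auto simp: group_hom_axioms_def hom_def BijGroup_def Bij hom)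
qed

text \<open>
  The pieces and group elements are indexed by \<open>{..<m}\<close> and \<open>{..<n}\<close>. The translating elements
  are families and may repeat, and pieces may be empty.
\<close>

definition paradoxical_decomposition ::
  "('g, 'b) monoid_scheme \<Rightarrow> 'x set \<Rightarrow> ('x \<Rightarrow> 'g \<Rightarrow> 'x) \<Rightarrow> nat \<Rightarrow> nat \<Rightarrow>
    (nat \<Rightarrow> 'x set) \<Rightarrow> (nat \<Rightarrow> 'x set) \<Rightarrow> (nat \<Rightarrow> 'g) \<Rightarrow> (nat \<Rightarrow> 'g) \<Rightarrow> bool" where
  "paradoxical_decomposition G X act m n P Q g h \<longleftrightarrow>
     0 < m \<and> 0 < n \<and>
     (\<forall>i<m. P i \<subseteq> X) \<and> (\<forall>j<n. Q j \<subseteq> X) \<and>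
     disjoint_family_on P {..<m} \<and> disjoint_family_on Q {..<n} \<and>
     (\<forall>i<m. \<forall>j<n. P i \<inter> Q j = {}) \<and>
     (\<forall>i<m. g i \<in> carrier G) \<and> (\<forall>j<n. h j \<in> carrier G) \<and>
     X = (\<Union>i<m. (\<lambda>x. act x (g i)) ` P i) \<and>
     X = (\<Union>j<n. (\<lambda>x. act x (h j)) ` Q j)"

text \<open>In \<^typ>\<open>enat\<close> the infimum of the empty set is \<open>\<infinity>\<close> and that of a nonempty set is attained.\<close>

definition tarski_number ::
  "('g, 'b) monoid_scheme \<Rightarrow> 'x set \<Rightarrow> ('x \<Rightarrow> 'g \<Rightarrow> 'x) \<Rightarrow> enat" where
  "tarski_number G X act =
     Inf {enat (m + n) | m n. \<exists>P Q g h. paradoxical_decomposition G X act m n P Q g h}"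

definition group_tarski_number :: "('g, 'b) monoid_scheme \<Rightarrow> enat" where
  "group_tarski_number G = tarski_number G (carrier G) (\<otimes>\<^bsub>G\<^esub>)"

text \<open>
  Amenability of a discrete group: there is a finitely additive probability measure on all
  subsets of the group, invariant under right translation. Inversion exchanges right and left
  invariance, so the choice of side is immaterial.
\<close>

definition amenable_group :: "('g, 'b) monoid_scheme \<Rightarrow> bool" where
  "amenable_group G \<longleftrightarrow> group G \<and>
     (\<exists>\<mu> :: 'g set \<Rightarrow> real.
        (\<forall>A. A \<subseteq> carrier G \<longrightarrow> 0 \<le> \<mu> A) \<and>
        \<mu> (carrier G) = 1 \<and>
        (\<forall>A B. A \<subseteq> carrier G \<longrightarrow> B \<subseteq> carrier G \<longrightarrow> A \<inter> B = {} \<longrightarrow> \<mu> (A \<union> B) = \<mu> A + \<mu> B) \<and>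
        (\<forall>A g. A \<subseteq> carrier G \<longrightarrow> g \<in> carrier G \<longrightarrow> \<mu> (A #>\<^bsub>G\<^esub> g) = \<mu> A))"

definition point_stabilizer ::
  "('g, 'b) monoid_scheme \<Rightarrow> ('x \<Rightarrow> 'g \<Rightarrow> 'x) \<Rightarrow> 'x \<Rightarrow> ('g, 'b) monoid_scheme" where
  "point_stabilizer G act x = G\<lparr>carrier := stabilizer G (\<lambda>g y. act y g) x\<rparr>"

lemma (in right_group_action) group_point_stabilizer:
  assumes "x \<in> X"
  shows "group (point_stabilizer G act x)"
proof -
  have "subgroup {g \<in> carrier G. act x g = x} G"
  proof (rule subgroupI)
    show "{g \<in> carrier G. act x g = x} \<noteq> {}"
      using assms act_one by blast
    fix g assume "g \<in> {g \<in> carrier G. act x g = x}"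
    then show "inv g \<in> {g \<in> carrier G. act x g = x}"
      using assms act_mult[of x g "inv g"] act_one by auto
  qed (use assms act_mult in auto)
  then show ?thesis
    by (simp add: point_stabilizer_def stabilizer_def subgroup.subgroup_is_group)
qed

end

theory Submission
  imports Defs
begin

text \<open>
  Both parts follow from one principle: a paradoxical decomposition may be replaced by a
  fractional one, in which every point distributes a total weight of at most 1 among the pieces
  and every point still receives total weight at least 1 from each of the two families of
  translated pieces (\<open>tarski_number_le_of_fractional_decomposition\<close>). Summing the weights over
  finite sets gives Hall's condition for a bipartite graph between two copies of \<open>X\<close> and \<open>X\<close>,
  and Hall's theorem for infinite families of finite sets (\<open>infinite_marriage\<close>) turns the
  fractional decomposition into a genuine one with the same translating elements. It remains to
  find weights.

  For a subgroup \<open>H\<close> of finite index \<open>k\<close>, choose coset representatives \<open>\<rho>(c)\<close>. A translation of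
  \<open>X\<close> by \<open>a\<close> permutes the \<open>k\<close> sheets of the product of \<open>X\<close> with the set of cosets, and on the sheet
  of \<open>c\<close> it acts through the element \<open>\<rho>(c) a \<rho>(ca)\<^sup>-\<^sup>1\<close> of \<open>H\<close>. Averaging a decomposition of the
  \<open>G\<close>-action over the sheets, with weight \<open>1/k\<close> each, is a fractional decomposition for \<open>H\<close>
  (\<open>coset_weights_cover\<close>). The two families can be normalized to contain \<open>\<one>\<close>, which contributes
  \<open>\<one>\<close> on every sheet, so that each family of \<open>m\<close> elements gives at most \<open>1 + k(m - 1)\<close>
  elements of \<open>H\<close>. Adding the two counts explains the shift by 2 on both sides.

  For amenable point stabilizers, the elements that carry an orbit representative to a point \<open>y\<close>
  form a right coset of the stabilizer of the representative, and an invariant mean on this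
  stabilizer induces a mean on the coset. The weights of \<open>y\<close> are the means of the pieces of a decomposition of \<open>G\<close>
  (\<open>mean_weights_cover\<close>), hence \<open>T(X) \<le> T(G)\<close>. The reverse inequality holds for every action,
  because a decomposition of \<open>X\<close> pulls back along an orbit map (\<open>group_tarski_number_le\<close>).
\<close>

section \<open>Matchings of infinite families of finite sets\<close>

definition hall_condition :: "'i set \<Rightarrow> ('i \<Rightarrow> 'b set) \<Rightarrow> bool" where
  "hall_condition I A \<longleftrightarrow> (\<forall>J. finite J \<longrightarrow> J \<subseteq> I \<longrightarrow> card J \<le> card (\<Union>(A ` J)))"

lemma hall_conditionD:
  "\<lbrakk>hall_condition I A; finite J; J \<subseteq> I\<rbrakk> \<Longrightarrow> card J \<le> card (\<Union>(A ` J))"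
  by (simp add: hall_condition_def)

text \<open>
  If deleting either element broke the condition, there would be finite index sets witnessing
  this; both witnesses contain \<open>i\<close>. Counting the union and the intersection of their
  neighbourhoods, where the union has regained all of \<open>A i\<close>, gives a contradiction.
\<close>

lemma hall_condition_delete_one_of_two:
  assumes hall: "hall_condition I A" and fin: "\<And>j. j \<in> I \<Longrightarrow> finite (A j)"
    and i: "i \<in> I" and ab: "a \<noteq> b"
  shows "hall_condition I (A(i := A i - {a})) \<or> hall_condition I (A(i := A i - {b}))"
proof (rule ccontr)
  assume neg: "\<not> ?thesis"
  have bad: "\<exists>J. finite J \<and> J \<subseteq> I \<and> i \<notin> J \<and> card (\<Union>(A ` J) \<union> (A i - {c})) \<le> card J"
    if c: "\<not> hall_condition I (A(i := A i - {c}))" for c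
  proof -
    obtain J where J: "finite J" "J \<subseteq> I" "card (\<Union>((A(i := A i - {c})) ` J)) < card J"
      using c unfolding hall_condition_def not_le[symmetric] by blast
    have "i \<in> J"
    proof (rule ccontr)
      assume "i \<notin> J"
      then have "(A(i := A i - {c})) ` J = A ` J" by (intro image_cong) auto
      moreover have "card J \<le> card (\<Union>(A ` J))" using J by (intro hall_conditionD[OF hall])
      ultimately show False using J(3) by simp
    qed
    have "\<Union>((A(i := A i - {c})) ` J) = \<Union>(A ` (J - {i})) \<union> (A i - {c})"
      using \<open>i \<in> J\<close> by (auto split: if_splits)
    with J(3) have "card (\<Union>(A ` (J - {i})) \<union> (A i - {c})) < card J" by (simp only:)
    moreover have "card J = Suc (card (J - {i}))"
      using J(1) \<open>i \<in> J\<close> by (rule card.remove)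
    ultimately have "card (\<Union>(A ` (J - {i})) \<union> (A i - {c})) \<le> card (J - {i})" by linarith
    with J(1,2) show ?thesis by (intro exI[of _ "J - {i}"]) blast
  qed
  obtain J where J: "finite J" "J \<subseteq> I" "i \<notin> J" "card (\<Union>(A ` J) \<union> (A i - {a})) \<le> card J"
    using bad[of a] neg by blast
  obtain K where K: "finite K" "K \<subseteq> I" "i \<notin> K" "card (\<Union>(A ` K) \<union> (A i - {b})) \<le> card K"
    using bad[of b] neg by blast
  let ?U = "\<Union>(A ` J) \<union> (A i - {a})" and ?V = "\<Union>(A ` K) \<union> (A i - {b})"
  have finUV: "finite ?U" "finite ?V" using J K fin i by auto
  have "card (insert i (J \<union> K)) \<le> card (\<Union>(A ` insert i (J \<union> K)))"
    using J(1,2) K(1,2) i by (intro hall_conditionD[OF hall]) auto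
  also have "\<Union>(A ` insert i (J \<union> K)) = ?U \<union> ?V" using ab by auto
  finally have 1: "Suc (card (J \<union> K)) \<le> card (?U \<union> ?V)" using J K by simp
  have "card (J \<inter> K) \<le> card (\<Union>(A ` (J \<inter> K)))"
    using J(1,2) by (intro hall_conditionD[OF hall]) auto
  also have "\<dots> \<le> card (?U \<inter> ?V)" using finUV by (intro card_mono) auto
  finally have 2: "card (J \<inter> K) \<le> card (?U \<inter> ?V)" .
  show False
    using 1 2 J(4) K(4) card_Un_Int[OF J(1) K(1)] card_Un_Int[OF finUV] by linarith
qed

text \<open>
  Marshall Hall's marriage theorem. Removing points from the sets for as long as the Hall
  condition permits ends with singletons; these form the matching. Zorn's lemma applies because
  each instance of the condition involves finitely many finite sets, and so depends on finitely
  many of the removals.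
\<close>

theorem infinite_marriage:
  assumes hall: "hall_condition I A" and fin: "\<And>i. i \<in> I \<Longrightarrow> finite (A i)"
  obtains f where "inj_on f I" "\<And>i. i \<in> I \<Longrightarrow> f i \<in> A i"
proof -
  \<comment> \<open>\<open>D\<close> records the removals: a pair \<open>(i, a)\<close> in \<open>D\<close> means that \<open>a\<close> is deleted from \<open>A i\<close>.\<close>
  define B where "B D i = A i - D `` {i}" for D i
  have "\<exists>M\<in>{D. hall_condition I (B D)}. \<forall>D\<in>{D. hall_condition I (B D)}. M \<subseteq> D \<longrightarrow> D = M"
  proof (rule subset_Zorn_nonempty)
    have "B {} = A" by (auto simp: B_def)
    then show "{D. hall_condition I (B D)} \<noteq> {}" using hall by (auto intro!: exI[of _ "{}"])
  next
    fix C assume C: "C \<noteq> {}" "subset.chain {D. hall_condition I (B D)} C"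
    have "card J \<le> card (\<Union>(B (\<Union>C) ` J))" if J: "finite J" "J \<subseteq> I" for J
    proof -
      have "finite (\<Union>C \<inter> Sigma J A)" using J fin by blast
      then obtain D where D: "D \<in> C" "\<Union>C \<inter> Sigma J A \<subseteq> D"
        using finite_subset_Union_chain[OF _ _ C] by (metis inf_le1)
      have "B (\<Union>C) j = B D j" if "j \<in> J" for j
        using D that unfolding B_def by blast
      then have "\<Union>(B (\<Union>C) ` J) = \<Union>(B D ` J)" by simp
      moreover have "hall_condition I (B D)" using C D unfolding subset.chain_def by auto
      ultimately show ?thesis using J unfolding hall_condition_def by simp
    qed
    then show "\<Union>C \<in> {D. hall_condition I (B D)}" by (simp add: hall_condition_def)
  qed
  then obtain M where M: "hall_condition I (B M)"
    and max: "\<And>D. hall_condition I (B D) \<Longrightarrow> M \<subseteq> D \<Longrightarrow> D = M" by blast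
  have finB: "finite (B M i)" if "i \<in> I" for i using fin that by (simp add: B_def)
  have single: "\<exists>a. B M i = {a}" if i: "i \<in> I" for i
  proof -
    have "card {i} \<le> card (\<Union>(B M ` {i}))"
      using i by (intro hall_conditionD[OF M]) auto
    then have "1 \<le> card (B M i)" by simp
    moreover have "a = b" if ab: "a \<in> B M i" "b \<in> B M i" for a b
    proof (rule ccontr)
      assume "a \<noteq> b"
      then obtain c where c: "c \<in> {a, b}" "hall_condition I ((B M)(i := B M i - {c}))"
        using hall_condition_delete_one_of_two[OF M finB i] by blast
      have "(B M)(i := B M i - {c}) = B (insert (i, c) M)" by (auto simp: B_def fun_eq_iff)
      with c(2) have "insert (i, c) M = M" by (intro max) auto
      with c(1) ab show False unfolding B_def by blast
    qed
    ultimately show ?thesis by (metis card.empty not_one_le_zero all_not_in_conv singleton_iff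
          subsetI subset_antisym)
  qed
  then obtain f where f: "\<And>i. i \<in> I \<Longrightarrow> B M i = {f i}" by metis
  have "inj_on f I"
  proof (rule inj_onI, rule ccontr)
    fix i j assume ij: "i \<in> I" "j \<in> I" "f i = f j" "i \<noteq> j"
    have "card {i, j} \<le> card (\<Union>(B M ` {i, j}))"
      using ij by (intro hall_conditionD[OF M]) auto
    also have "\<Union>(B M ` {i, j}) = {f i}" using f ij by simp
    finally show False using ij by simp
  qed
  moreover have "f i \<in> A i" if "i \<in> I" for i using f[OF that] by (auto simp: B_def)
  ultimately show thesis by (rule that)
qed

section \<open>Finitely additive measures\<close>

locale finitely_additive =
  fixes \<Omega> :: "'a set" and \<mu> :: "'a set \<Rightarrow> real"
  assumes nonneg: "A \<subseteq> \<Omega> \<Longrightarrow> 0 \<le> \<mu> A"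
    and additive: "\<lbrakk>A \<subseteq> \<Omega>; B \<subseteq> \<Omega>; A \<inter> B = {}\<rbrakk> \<Longrightarrow> \<mu> (A \<union> B) = \<mu> A + \<mu> B"
begin

lemma measure_empty: "\<mu> {} = 0"
  using additive[of "{}" "{}"] by simp

lemma measure_mono:
  assumes "A \<subseteq> B" "B \<subseteq> \<Omega>"
  shows "\<mu> A \<le> \<mu> B"
proof -
  have "\<mu> (A \<union> (B - A)) = \<mu> A + \<mu> (B - A)" using assms by (intro additive) auto
  moreover have "A \<union> (B - A) = B" using assms by blast
  ultimately show ?thesis using nonneg[of "B - A"] assms by auto
qed

lemma measure_UN_le:
  assumes "finite I" "\<And>i. i \<in> I \<Longrightarrow> A i \<subseteq> \<Omega>"
  shows "\<mu> (\<Union>i\<in>I. A i) \<le> (\<Sum>i\<in>I. \<mu> (A i))"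
  using assms
proof (induction I)
  case (insert i I)
  let ?U = "\<Union>j\<in>I. A j"
  have "\<mu> ((A i - ?U) \<union> ?U) = \<mu> (A i - ?U) + \<mu> ?U" using insert.prems by (intro additive) auto
  moreover have "(A i - ?U) \<union> ?U = (\<Union>j\<in>insert i I. A j)" by auto
  moreover have "\<mu> (A i - ?U) \<le> \<mu> (A i)" using insert.prems by (intro measure_mono) auto
  ultimately show ?case using insert by auto
qed (simp add: measure_empty)

lemma measure_UN_disjoint:
  assumes "finite I" "\<And>i. i \<in> I \<Longrightarrow> A i \<subseteq> \<Omega>" "disjoint_family_on A I"
  shows "\<mu> (\<Union>i\<in>I. A i) = (\<Sum>i\<in>I. \<mu> (A i))"
  using assms
proof (induction I)
  case (insert i I)
  have "\<mu> (A i \<union> (\<Union>j\<in>I. A j)) = \<mu> (A i) + \<mu> (\<Union>j\<in>I. A j)"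
    using insert by (intro additive) (auto simp: disjoint_family_on_def)
  then show ?case using insert by (auto simp: disjoint_family_on_def)
qed (simp add: measure_empty)

lemma sum_measure_two_disjoint_families_le:
  assumes "finite I" "\<And>i. i \<in> I \<Longrightarrow> A i \<subseteq> \<Omega>" "disjoint_family_on A I"
    and "finite J" "\<And>j. j \<in> J \<Longrightarrow> B j \<subseteq> \<Omega>" "disjoint_family_on B J"
    and "\<And>i j. i \<in> I \<Longrightarrow> j \<in> J \<Longrightarrow> A i \<inter> B j = {}"
  shows "(\<Sum>i\<in>I. \<mu> (A i)) + (\<Sum>j\<in>J. \<mu> (B j)) \<le> \<mu> \<Omega>"
proof -
  have "(\<Sum>i\<in>I. \<mu> (A i)) + (\<Sum>j\<in>J. \<mu> (B j)) = \<mu> (\<Union>i\<in>I. A i) + \<mu> (\<Union>j\<in>J. B j)"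
    using assms by (simp add: measure_UN_disjoint)
  also have "\<dots> = \<mu> ((\<Union>i\<in>I. A i) \<union> (\<Union>j\<in>J. B j))"
    using assms by (intro additive[symmetric]) blast+
  also have "\<dots> \<le> \<mu> \<Omega>" using assms by (intro measure_mono) auto
  finally show ?thesis .
qed

end

lemma finitely_additive_point_mass: "finitely_additive \<Omega> (\<lambda>A. of_bool (y \<in> A))"
  by unfold_locales auto

section \<open>Bounding Tarski numbers by fractional decompositions\<close>

lemma tarski_number_le:
  assumes "paradoxical_decomposition G X act m n P Q g h"
  shows "tarski_number G X act \<le> enat (m + n)"
  unfolding tarski_number_def using assms by (intro Inf_lower) blast

lemma tarski_number_greatest:
  assumes "\<And>m n P Q g h. paradoxical_decomposition G X act m n P Q g h \<Longrightarrow> c \<le> enat (m + n)"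
  shows "c \<le> tarski_number G X act"
  unfolding tarski_number_def using assms by (intro Inf_greatest) blast

lemma tarski_number_attained:
  assumes "tarski_number G X act \<noteq> \<infinity>"
  obtains m n P Q g h where "paradoxical_decomposition G X act m n P Q g h"
    "tarski_number G X act = enat (m + n)"
proof -
  let ?S = "{enat (m + n) | m n. \<exists>P Q g h. paradoxical_decomposition G X act m n P Q g h}"
  have "?S \<noteq> {}"
    using assms unfolding tarski_number_def by (metis (no_types, lifting) Inf_empty top_enat_def)
  then have "Inf ?S \<in> ?S" unfolding Inf_enat_def by (metis (no_types, lifting) LeastI ex_in_conv)
  then show thesis using that unfolding tarski_number_def by blast
qed

context right_group_action
begin

lemma act_act_inv: "\<lbrakk>x \<in> X; g \<in> carrier G\<rbrakk> \<Longrightarrow> act (act x g) (inv g) = x"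
  and act_inv_act: "\<lbrakk>x \<in> X; g \<in> carrier G\<rbrakk> \<Longrightarrow> act (act x (inv g)) g = x"
  using act_mult[of x g "inv g"] act_mult[of x "inv g" g] act_one by auto

lemma inj_on_act: "g \<in> carrier G \<Longrightarrow> A \<subseteq> X \<Longrightarrow> inj_on (\<lambda>x. act x g) A"
  by (rule inj_on_inverseI[of _ "\<lambda>x. act x (inv g)"]) (auto simp: act_act_inv)

lemma translates_cover_iff:
  assumes "\<And>i. i \<in> I \<Longrightarrow> P i \<subseteq> X" "\<And>i. i \<in> I \<Longrightarrow> g i \<in> carrier G"
  shows "X = (\<Union>i\<in>I. (\<lambda>x. act x (g i)) ` P i) \<longleftrightarrow> (\<forall>x\<in>X. \<exists>i\<in>I. act x (inv (g i)) \<in> P i)"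
proof
  assume X: "X = (\<Union>i\<in>I. (\<lambda>x. act x (g i)) ` P i)"
  show "\<forall>x\<in>X. \<exists>i\<in>I. act x (inv (g i)) \<in> P i"
  proof
    fix x assume "x \<in> X"
    then obtain i y where "i \<in> I" "y \<in> P i" "x = act y (g i)" using X by blast
    then have "act x (inv (g i)) = y" using act_act_inv assms by (simp add: subset_iff)
    with \<open>i \<in> I\<close> \<open>y \<in> P i\<close> show "\<exists>i\<in>I. act x (inv (g i)) \<in> P i" by blast
  qed
next
  assume cov: "\<forall>x\<in>X. \<exists>i\<in>I. act x (inv (g i)) \<in> P i"
  show "X = (\<Union>i\<in>I. (\<lambda>x. act x (g i)) ` P i)"
  proof (intro equalityI subsetI)
    fix x assume "x \<in> X"
    then obtain i where "i \<in> I" "act x (inv (g i)) \<in> P i" using cov by blast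
    moreover from this have "x = act (act x (inv (g i))) (g i)"
      using act_inv_act[OF \<open>x \<in> X\<close>] assms(2) by simp
    ultimately show "x \<in> (\<Union>i\<in>I. (\<lambda>x. act x (g i)) ` P i)" by blast
  qed (use assms act_closed in blast)
qed

text \<open>The weights are located at preimages of points, so covers are expressed through preimages.\<close>

lemma paradoxical_decomposition_iff:
  "paradoxical_decomposition G X act m n P Q g h \<longleftrightarrow>
     0 < m \<and> 0 < n \<and>
     (\<forall>i<m. P i \<subseteq> X) \<and> (\<forall>j<n. Q j \<subseteq> X) \<and>
     disjoint_family_on P {..<m} \<and> disjoint_family_on Q {..<n} \<and>
     (\<forall>i<m. \<forall>j<n. P i \<inter> Q j = {}) \<and>
     (\<forall>i<m. g i \<in> carrier G) \<and> (\<forall>j<n. h j \<in> carrier G) \<and>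
     (\<forall>x\<in>X. \<exists>i<m. act x (inv (g i)) \<in> P i) \<and>
     (\<forall>x\<in>X. \<exists>j<n. act x (inv (h j)) \<in> Q j)"
proof -
  define C where "C l R k \<longleftrightarrow> X = (\<Union>i<l. (\<lambda>x. act x (k i)) ` R i)" for l :: nat and R k
  have "C l R k \<longleftrightarrow> (\<forall>x\<in>X. \<exists>i<l. act x (inv (k i)) \<in> R i)"
    if "\<forall>i<l. R i \<subseteq> X" "\<forall>i<l. k i \<in> carrier G" for l R k
    unfolding C_def using that translates_cover_iff[of "{..<l}" R k]
    by (simp only: lessThan_iff Bex_def)
  then show ?thesis
    unfolding paradoxical_decomposition_def C_def[symmetric] by (simp cong: conj_cong)
qed

text \<open>
  The pieces of a decomposition are the parts of the range of \<open>f\<close> on which a given element of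
  \<open>S\<close> undoes \<open>f\<close>.
\<close>

lemma pieces_of_piecewise_translation:
  assumes S: "finite S" "S \<subseteq> carrier G" and inj: "inj_on f X"
    and f: "\<And>x. x \<in> X \<Longrightarrow> \<exists>s\<in>S. f x = act x (inv s)"
  obtains P g where "disjoint_family_on P {..<card S}" "\<And>i. P i \<subseteq> f ` X"
    "\<forall>i<card S. g i \<in> carrier G" "\<forall>x\<in>X. \<exists>i<card S. act x (inv (g i)) \<in> P i"
proof -
  obtain g where g: "bij_betw g {..<card S} S"
    using ex_bij_betw_nat_finite[OF S(1)] by (auto simp: atLeast0LessThan)
  then have gS: "g ` {..<card S} = S" by (simp add: bij_betw_def)
  have "\<exists>i<card S. f x = act x (inv (g i))" if "x \<in> X" for x
  proof -
    obtain s where s: "s \<in> S" "f x = act x (inv s)" using f[OF \<open>x \<in> X\<close>] by blast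
    then obtain i where "i < card S" "s = g i" using gS by (metis imageE lessThan_iff)
    with s show ?thesis by blast
  qed
  then obtain k where k: "\<And>x. x \<in> X \<Longrightarrow> k x < card S \<and> f x = act x (inv (g (k x)))" by metis
  show thesis
  proof (rule that)
    let ?P = "\<lambda>i. f ` {x \<in> X. k x = i}"
    show "disjoint_family_on ?P {..<card S}"
      using inj by (auto simp: disjoint_family_on_def inj_on_def)
    show "?P i \<subseteq> f ` X" for i by auto
    show "\<forall>x\<in>X. \<exists>i<card S. act x (inv (g i)) \<in> ?P i"
    proof
      fix x assume "x \<in> X"
      then have "act x (inv (g (k x))) \<in> ?P (k x)" "k x < card S"
        using k[of x] by (auto intro!: image_eqI[of _ _ x])
      then show "\<exists>i<card S. act x (inv (g i)) \<in> ?P i" by blast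
    qed
  qed (use S(2) gS in blast)
qed

lemma tarski_number_le_of_piecewise_translations:
  assumes S: "finite S" "S \<subseteq> carrier G" and T: "finite T" "T \<subseteq> carrier G"
    and inj: "inj_on f X" "inj_on f' X" and disj: "f ` X \<inter> f' ` X = {}"
    and f: "\<And>x. x \<in> X \<Longrightarrow> \<exists>s\<in>S. f x = act x (inv s)"
    and f': "\<And>x. x \<in> X \<Longrightarrow> \<exists>s\<in>T. f' x = act x (inv s)"
  shows "tarski_number G X act \<le> enat (card S + card T)"
proof -
  obtain P g where P: "disjoint_family_on P {..<card S}" "\<And>i. P i \<subseteq> f ` X"
    "\<forall>i<card S. g i \<in> carrier G" "\<forall>x\<in>X. \<exists>i<card S. act x (inv (g i)) \<in> P i"
    using pieces_of_piecewise_translation[OF S inj(1) f] by metis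
  obtain Q h where Q: "disjoint_family_on Q {..<card T}" "\<And>i. Q i \<subseteq> f' ` X"
    "\<forall>i<card T. h i \<in> carrier G" "\<forall>x\<in>X. \<exists>i<card T. act x (inv (h i)) \<in> Q i"
    using pieces_of_piecewise_translation[OF T inj(2) f'] by metis
  have "f x \<in> X" if x: "x \<in> X" for x
    using f[OF x] S(2) act_closed[OF x] by (metis inv_closed subsetD)
  moreover have "f' x \<in> X" if x: "x \<in> X" for x
    using f'[OF x] T(2) act_closed[OF x] by (metis inv_closed subsetD)
  ultimately have PX: "P i \<subseteq> X" "Q j \<subseteq> X" for i j using P(2)[of i] Q(2)[of j] by blast+
  have PQ: "P i \<inter> Q j = {}" for i j using P(2)[of i] Q(2)[of j] disj by blast
  have "S \<noteq> {}" "T \<noteq> {}" using nonempty f f' by blast+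
  then have "0 < card S" "0 < card T" using S T by (auto simp: card_gt_0_iff)
  then have "paradoxical_decomposition G X act (card S) (card T) P Q g h"
    unfolding paradoxical_decomposition_iff using P(1,3,4) Q(1,3,4) PX PQ by simp
  then show ?thesis by (rule tarski_number_le)
qed

text \<open>
  Each point of \<open>A\<close> receives total weight at least 1 from its preimages, all of which lie
  in \<open>U\<close>, and for fixed \<open>i\<close> distinct points have distinct preimages.
\<close>

lemma card_le_weight_of_preimages:
  fixes p :: "'i \<Rightarrow> 'x \<Rightarrow> real"
  assumes "\<And>i. i \<in> I \<Longrightarrow> \<sigma> i \<in> carrier G" and U: "finite U" "U \<subseteq> X"
    and A: "finite A" "A \<subseteq> X"
    and AU: "\<And>x i. x \<in> A \<Longrightarrow> i \<in> I \<Longrightarrow> act x (inv (\<sigma> i)) \<in> U"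
    and nonneg: "\<And>i y. i \<in> I \<Longrightarrow> y \<in> X \<Longrightarrow> 0 \<le> p i y"
    and cover: "\<And>x. x \<in> X \<Longrightarrow> 1 \<le> (\<Sum>i\<in>I. p i (act x (inv (\<sigma> i))))"
  shows "real (card A) \<le> (\<Sum>y\<in>U. \<Sum>i\<in>I. p i y)"
proof -
  have "real (card A) \<le> (\<Sum>x\<in>A. \<Sum>i\<in>I. p i (act x (inv (\<sigma> i))))"
    using sum_mono[of A "\<lambda>_. 1::real" "\<lambda>x. \<Sum>i\<in>I. p i (act x (inv (\<sigma> i)))"] cover A by auto
  also have "\<dots> = (\<Sum>i\<in>I. \<Sum>x\<in>A. p i (act x (inv (\<sigma> i))))" by (rule sum.swap)
  also have "\<dots> \<le> (\<Sum>i\<in>I. \<Sum>y\<in>U. p i y)"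
  proof (rule sum_mono)
    fix i assume i: "i \<in> I"
    then have "(\<Sum>x\<in>A. p i (act x (inv (\<sigma> i)))) = (\<Sum>y\<in>(\<lambda>x. act x (inv (\<sigma> i))) ` A. p i y)"
      using assms(1) A(2) by (subst sum.reindex) (auto intro: inj_on_act)
    also have "\<dots> \<le> (\<Sum>y\<in>U. p i y)" using U AU i nonneg by (intro sum_mono2) auto
    finally show "(\<Sum>x\<in>A. p i (act x (inv (\<sigma> i)))) \<le> (\<Sum>y\<in>U. p i y)" .
  qed
  also have "\<dots> = (\<Sum>y\<in>U. \<Sum>i\<in>I. p i y)" by (rule sum.swap)
  finally show ?thesis .
qed

text \<open>
  A fractional paradoxical decomposition: \<open>p i y\<close> is the share of the point \<open>y\<close> that belongs to
  the \<open>i\<close>-th piece. The weights verify the Hall condition for the bipartite graph in which two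
  copies of \<open>x\<close> are joined to the points that \<open>\<sigma>\<close>, respectively \<open>\<tau>\<close>, can move to \<open>x\<close>, and a
  matching of this graph is a genuine decomposition. Only the sets of translating elements
  enter the graph, so indices with the same element are counted once.
\<close>

theorem tarski_number_le_of_fractional_decomposition:
  fixes p :: "'i \<Rightarrow> 'x \<Rightarrow> real" and q :: "'j \<Rightarrow> 'x \<Rightarrow> real"
  assumes I: "finite I" "\<And>i. i \<in> I \<Longrightarrow> \<sigma> i \<in> carrier G"
    and J: "finite J" "\<And>j. j \<in> J \<Longrightarrow> \<tau> j \<in> carrier G"
    and p: "\<And>i y. i \<in> I \<Longrightarrow> y \<in> X \<Longrightarrow> 0 \<le> p i y"
    and q: "\<And>j y. j \<in> J \<Longrightarrow> y \<in> X \<Longrightarrow> 0 \<le> q j y"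
    and packing: "\<And>y. y \<in> X \<Longrightarrow> (\<Sum>i\<in>I. p i y) + (\<Sum>j\<in>J. q j y) \<le> 1"
    and cover_p: "\<And>x. x \<in> X \<Longrightarrow> 1 \<le> (\<Sum>i\<in>I. p i (act x (inv (\<sigma> i))))"
    and cover_q: "\<And>x. x \<in> X \<Longrightarrow> 1 \<le> (\<Sum>j\<in>J. q j (act x (inv (\<tau> j))))"
  shows "tarski_number G X act \<le> enat (card (\<sigma> ` I) + card (\<tau> ` J))"
proof -
  define N where "N = case_sum (\<lambda>x. (\<lambda>i. act x (inv (\<sigma> i))) ` I) (\<lambda>x. (\<lambda>j. act x (inv (\<tau> j))) ` J)"
  have finN: "finite (N k)" for k using I J by (auto simp: N_def split: sum.split)
  have "hall_condition (X <+> X) N"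
    unfolding hall_condition_def
  proof (intro allI impI)
    fix K assume K: "finite K" "K \<subseteq> X <+> X"
    define A where "A = {x. Inl x \<in> K}"
    define B where "B = {x. Inr x \<in> K}"
    define U where "U = \<Union>(N ` K)"
    have KAB: "K = A <+> B" unfolding A_def B_def
      by (auto simp: Plus_def image_iff) (metis sum.exhaust)
    then have AB: "finite A" "finite B" "A \<subseteq> X" "B \<subseteq> X" using K by (auto simp: finite_Plus_iff)
    have U: "finite U" "U \<subseteq> X"
      using K finN AB I(2) J(2) unfolding U_def KAB by (auto simp: N_def intro!: act_closed)
    have "real (card K) = real (card A) + real (card B)" using AB KAB by (simp add: card_Plus)
    also have "\<dots> \<le> (\<Sum>y\<in>U. \<Sum>i\<in>I. p i y) + (\<Sum>y\<in>U. \<Sum>j\<in>J. q j y)"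
    proof (rule add_mono)
      have "act x (inv (\<sigma> i)) \<in> U" if "x \<in> A" "i \<in> I" for x i
        using that unfolding U_def KAB by (intro UN_I[of "Inl x"]) (auto simp: N_def)
      then show "real (card A) \<le> (\<Sum>y\<in>U. \<Sum>i\<in>I. p i y)"
        using I(2) U AB p cover_p by (intro card_le_weight_of_preimages[where \<sigma> = \<sigma>]) auto
      have "act x (inv (\<tau> j)) \<in> U" if "x \<in> B" "j \<in> J" for x j
        using that unfolding U_def KAB by (intro UN_I[of "Inr x"]) (auto simp: N_def)
      then show "real (card B) \<le> (\<Sum>y\<in>U. \<Sum>j\<in>J. q j y)"
        using J(2) U AB q cover_q by (intro card_le_weight_of_preimages[where \<sigma> = \<tau>]) auto
    qed
    also have "\<dots> = (\<Sum>y\<in>U. (\<Sum>i\<in>I. p i y) + (\<Sum>j\<in>J. q j y))" by (simp add: sum.distrib)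
    also have "\<dots> \<le> (\<Sum>y\<in>U. 1)" using U packing by (intro sum_mono) auto
    finally show "card K \<le> card (\<Union>(N ` K))" by (simp add: U_def)
  qed
  then obtain f where f: "inj_on f (X <+> X)" "\<And>k. k \<in> X <+> X \<Longrightarrow> f k \<in> N k"
    using infinite_marriage finN by metis
  show ?thesis
  proof (rule tarski_number_le_of_piecewise_translations)
    show "inj_on (f \<circ> Inl) X" "inj_on (f \<circ> Inr) X" "(f \<circ> Inl) ` X \<inter> (f \<circ> Inr) ` X = {}"
      using f(1) by (auto simp: inj_on_def)
    show "\<exists>s\<in>\<sigma> ` I. (f \<circ> Inl) x = act x (inv s)" if "x \<in> X" for x
      using f(2)[of "Inl x"] that by (auto simp: N_def)
    show "\<exists>s\<in>\<tau> ` J. (f \<circ> Inr) x = act x (inv s)" if "x \<in> X" for x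
      using f(2)[of "Inr x"] that by (auto simp: N_def)
  qed (use I J in auto)
qed

section \<open>Restriction to a subgroup of finite index\<close>

text \<open>
  Since \<open>X\<close> is invariant under \<open>G\<close>, a family of translates that covers \<open>X\<close> still does so after a
  further translation by one common element.
\<close>

lemma normalize_decomposition:
  assumes "paradoxical_decomposition G X act m n P Q g h"
  obtains g' h' where "paradoxical_decomposition G X act m n P Q g' h'" "g' 0 = \<one>" "h' 0 = \<one>"
proof -
  have norm: "\<forall>x\<in>X. \<exists>i<l. act x (inv (k i \<otimes> inv (k 0))) \<in> R i"
    if l: "0 < l" and k: "\<forall>i<l. k i \<in> carrier G"
      and cov: "\<forall>x\<in>X. \<exists>i<l. act x (inv (k i)) \<in> R i" for l :: nat and R :: "nat \<Rightarrow> 'x set" and k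
  proof
    fix x assume x: "x \<in> X"
    then obtain i where i: "i < l" "act (act x (k 0)) (inv (k i)) \<in> R i"
      using cov act_closed k l by blast
    then have "act x (inv (k i \<otimes> inv (k 0))) \<in> R i"
      using x k l by (simp add: inv_mult_group act_mult)
    with i show "\<exists>i<l. act x (inv (k i \<otimes> inv (k 0))) \<in> R i" by blast
  qed
  show thesis
  proof (rule that)
    show "paradoxical_decomposition G X act m n P Q
      (\<lambda>i. g i \<otimes> inv (g 0)) (\<lambda>j. h j \<otimes> inv (h 0))"
      using assms norm[of m g P] norm[of n h Q] unfolding paradoxical_decomposition_iff by simp
  qed (use assms in \<open>auto simp: paradoxical_decomposition_iff\<close>)
qed

context
  fixes H :: "'a set"
  assumes H: "subgroup H G" and fin_index: "finite (rcosets H)"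
begin

definition coset_rep :: "'a set \<Rightarrow> 'a" where
  "coset_rep c = (SOME a. a \<in> carrier G \<and> c = H #> a)"

lemma coset_rep: "c \<in> rcosets H \<Longrightarrow> coset_rep c \<in> carrier G \<and> c = H #> coset_rep c"
  unfolding coset_rep_def by (rule someI_ex) (auto simp: RCOSETS_def)

lemma rcoset_translate:
  assumes "c \<in> rcosets H" "a \<in> carrier G"
  shows "c #> a = H #> (coset_rep c \<otimes> a)" "c #> a \<in> rcosets H" "c #> a #> inv a = c"
    "c #> inv a #> a = c"
proof -
  note c = coset_rep[OF assms(1)]
  have HG: "H \<subseteq> carrier G" by (rule subgroup.subset[OF H])
  then have cG: "c \<subseteq> carrier G" using c r_coset_subset_G by metis
  show "c #> a = H #> (coset_rep c \<otimes> a)"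
    using coset_mult_assoc[OF HG, of "coset_rep c" a] c assms(2) by auto
  then show "c #> a \<in> rcosets H" using c assms(2) by (auto simp: RCOSETS_def)
  show "c #> a #> inv a = c" "c #> inv a #> a = c"
    using cG assms(2) by (simp_all add: coset_mult_assoc coset_mult_one)
qed

text \<open>
  The group acts diagonally on pairs of a point of \<open>X\<close> and a coset. In the coordinates
  \<open>(x, c) \<mapsto> (act x (coset_rep c), c)\<close>, the element \<open>a\<close> moves \<open>(x, c)\<close> to
  \<open>(act x (coset_cocycle c a), c #> a)\<close>: on the sheet of \<open>c\<close> it acts through an element of \<open>H\<close>.
\<close>

definition coset_cocycle :: "'a set \<Rightarrow> 'a \<Rightarrow> 'a" where
  "coset_cocycle c a = coset_rep c \<otimes> a \<otimes> inv (coset_rep (c #> a))"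

lemma coset_cocycle_mem:
  assumes "c \<in> rcosets H" "a \<in> carrier G"
  shows "coset_cocycle c a \<in> H"
proof -
  let ?b = "coset_rep c \<otimes> a" and ?r = "coset_rep (c #> a)"
  have mem: "?b \<in> carrier G" "?r \<in> carrier G" and eq: "H #> ?b = H #> ?r"
    using assms coset_rep rcoset_translate[OF assms] by auto
  have "?b \<in> H #> ?r" using eq rcos_self[OF mem(1) H] by simp
  then obtain h where "h \<in> H" "?b = h \<otimes> ?r" by (auto simp: r_coset_def)
  then show ?thesis
    using mem subgroup.mem_carrier[OF H] unfolding coset_cocycle_def by (simp add: m_assoc)
qed

lemma coset_cocycle_one: "c \<in> rcosets H \<Longrightarrow> coset_cocycle c \<one> = \<one>"
  using coset_rep[of c] subgroup.subset[OF H] r_coset_subset_G[of H "coset_rep c"]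
  by (simp add: coset_cocycle_def coset_mult_one)

lemma card_rcosets_pos: "0 < card (rcosets H)"
  using fin_index by (auto simp: card_gt_0_iff RCOSETS_def)

text \<open>
  With the trivial first element, all sheets contribute the same element \<open>\<one>\<close>, so the
  \<open>m\<close> elements yield at most \<open>1 + [G : H] (m - 1)\<close> cocycle values.
\<close>

lemma card_coset_cocycle_image:
  assumes m: "0 < m" and g0: "g 0 = \<one>"
  shows "card ((\<lambda>(c, i). coset_cocycle c (g i)) ` ((rcosets H) \<times> {..<m}))
    \<le> Suc (card (rcosets H) * (m - 1))"
proof -
  let ?\<sigma> = "\<lambda>(c, i). coset_cocycle c (g i)"
  have "?\<sigma> ` ((rcosets H) \<times> {..<m}) \<subseteq> insert \<one> (?\<sigma> ` ((rcosets H) \<times> {1..<m}))"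
  proof
    fix s assume "s \<in> ?\<sigma> ` ((rcosets H) \<times> {..<m})"
    then obtain c i where ci: "c \<in> rcosets H" "i < m" "s = coset_cocycle c (g i)" by auto
    show "s \<in> insert \<one> (?\<sigma> ` ((rcosets H) \<times> {1..<m}))"
    proof (cases "i = 0")
      case True
      then show ?thesis using ci g0 coset_cocycle_one by simp
    next
      case False
      then show ?thesis using ci by (force intro!: image_eqI[of _ _ "(c, i)"])
    qed
  qed
  then have "card (?\<sigma> ` ((rcosets H) \<times> {..<m})) \<le> card (insert \<one> (?\<sigma> ` ((rcosets H) \<times> {1..<m})))"
    using fin_index by (intro card_mono) auto
  also have "\<dots> \<le> Suc (card (?\<sigma> ` ((rcosets H) \<times> {1..<m})))" by (rule card_insert_le_m1) auto
  also have "\<dots> \<le> Suc (card ((rcosets H) \<times> {1..<m}))"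
    using fin_index by (intro Suc_le_mono[THEN iffD2] card_image_le) auto
  finally show ?thesis by (simp add: card_cartesian_product)
qed

text \<open>
  For each coset \<open>c\<close> some piece contains the point that a translation moves to
  \<open>act x (coset_rep c)\<close>; this provides one term of weight \<open>1 / [G : H]\<close>, located at the coset
  from which that translation leads to \<open>c\<close>.
\<close>

lemma coset_weights_cover:
  fixes m :: nat
  assumes g: "\<forall>i<m. g i \<in> carrier G" and x: "x \<in> X"
    and cov: "\<forall>x\<in>X. \<exists>i<m. act x (inv (g i)) \<in> P i"
  shows "1 \<le> (\<Sum>(c, i)\<in>(rcosets H) \<times> {..<m}.
    of_bool (act (act x (inv (coset_cocycle c (g i)))) (coset_rep c) \<in> P i) / real (card (rcosets H)))"
    (is "1 \<le> (\<Sum>(c, i)\<in>_. ?w c i)")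
proof -
  have "\<exists>i<m. act (act x (coset_rep c)) (inv (g i)) \<in> P i" if "c \<in> rcosets H" for c
    using cov act_closed[OF x] coset_rep[OF that] by blast
  then obtain k where k: "\<And>c. c \<in> rcosets H \<Longrightarrow> k c < m"
      "\<And>c. c \<in> rcosets H \<Longrightarrow> act (act x (coset_rep c)) (inv (g (k c))) \<in> P (k c)"
    by metis
  define F where "F c = (c #> inv (g (k c)), k c)" for c
  \<comment> \<open>A translation permutes the cosets, so distinct cosets yield distinct terms of the sum.\<close>
  have "inj_on F (rcosets H)"
    by (rule inj_on_inverseI[of _ "\<lambda>(c, i). c #> g i"]) (use k g rcoset_translate in \<open>auto simp: F_def\<close>)
  have F: "F ` (rcosets H) \<subseteq> (rcosets H) \<times> {..<m}"
    using k g rcoset_translate by (auto simp: F_def)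
  have w: "?w (c #> inv (g (k c))) (k c) = 1 / real (card (rcosets H))" if c: "c \<in> rcosets H" for c
  proof -
    let ?i = "k c" and ?d = "c #> inv (g (k c))"
    have gi: "g ?i \<in> carrier G" using g k c by blast
    have d: "?d \<in> rcosets H" "?d #> g ?i = c" using rcoset_translate c gi by auto
    have "inv (coset_cocycle ?d (g ?i)) \<otimes> coset_rep ?d = coset_rep c \<otimes> inv (g ?i)"
      using coset_rep[OF c] coset_rep[OF d(1)] gi
      unfolding coset_cocycle_def d(2) by (simp add: inv_mult_group m_assoc)
    then have "act (act x (inv (coset_cocycle ?d (g ?i)))) (coset_rep ?d)
      = act (act x (coset_rep c)) (inv (g ?i))"
      using x gi coset_rep[OF c] coset_rep[OF d(1)]
        subgroup.mem_carrier[OF H coset_cocycle_mem[OF d(1) gi]]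
      by (metis act_mult inv_closed)
    then show ?thesis using k(2)[OF c] by simp
  qed
  have "1 = (\<Sum>c\<in>(rcosets H). 1 / real (card (rcosets H)))" using card_rcosets_pos by simp
  also have "\<dots> = (\<Sum>c\<in>(rcosets H). case F c of (d, i) \<Rightarrow> ?w d i)"
    using w by (intro sum.cong) (auto simp: F_def)
  also have "\<dots> = (\<Sum>(d, i)\<in>F ` (rcosets H). ?w d i)"
    using \<open>inj_on F (rcosets H)\<close> by (simp add: sum.reindex o_def)
  also have "\<dots> \<le> (\<Sum>(d, i)\<in>(rcosets H) \<times> {..<m}. ?w d i)"
    using F fin_index by (intro sum_mono2) auto
  finally show ?thesis .
qed

text \<open>
  Average the decomposition over the cosets: the point \<open>y\<close> belongs to the piece with index
  \<open>(c, i)\<close> with weight \<open>1 / [G : H]\<close> if its translate by the representative of \<open>c\<close> lies in \<open>P i\<close>.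
\<close>

lemma tarski_number_subgroup_le:
  assumes "paradoxical_decomposition G X act m n P Q g h"
  shows "tarski_number (G\<lparr>carrier := H\<rparr>) X act \<le> enat (2 + card (rcosets H) * (m + n - 2))"
proof -
  obtain g' h' where dec: "paradoxical_decomposition G X act m n P Q g' h'"
    and one: "g' 0 = \<one>" "h' 0 = \<one>"
    using normalize_decomposition[OF assms] .
  interpret R: right_group_action "G\<lparr>carrier := H\<rparr>" X act by (rule restrict_subgroup[OF H])
  let ?C = "rcosets H" and ?k = "real (card (rcosets H))"
  let ?\<sigma> = "\<lambda>(c, i). coset_cocycle c (g' i)" and ?\<tau> = "\<lambda>(c, j). coset_cocycle c (h' j)"
  have pos: "0 < m" "0 < n" and gh: "\<forall>i<m. g' i \<in> carrier G" "\<forall>j<n. h' j \<in> carrier G"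
    and PQ: "\<forall>i<m. P i \<subseteq> X" "\<forall>j<n. Q j \<subseteq> X"
    and disj: "disjoint_family_on P {..<m}" "disjoint_family_on Q {..<n}"
      "\<forall>i<m. \<forall>j<n. P i \<inter> Q j = {}"
    and cov: "\<forall>x\<in>X. \<exists>i<m. act x (inv (g' i)) \<in> P i" "\<forall>x\<in>X. \<exists>j<n. act x (inv (h' j)) \<in> Q j"
    using dec unfolding paradoxical_decomposition_iff by blast+
  have inv_H: "inv\<^bsub>G\<lparr>carrier := H\<rparr>\<^esub> coset_cocycle c a = inv (coset_cocycle c a)"
    if "c \<in> ?C" "a \<in> carrier G" for c a
    using m_inv_consistent[OF H coset_cocycle_mem[OF that]] .
  have "tarski_number (G\<lparr>carrier := H\<rparr>) X act
    \<le> enat (card (?\<sigma> ` (?C \<times> {..<m})) + card (?\<tau> ` (?C \<times> {..<n})))"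
  proof (rule R.tarski_number_le_of_fractional_decomposition)
    show "finite (?C \<times> {..<m})" "finite (?C \<times> {..<n})" using fin_index by auto
    show "?\<sigma> k \<in> carrier (G\<lparr>carrier := H\<rparr>)" if "k \<in> ?C \<times> {..<m}" for k
      using that gh coset_cocycle_mem by auto
    show "?\<tau> k \<in> carrier (G\<lparr>carrier := H\<rparr>)" if "k \<in> ?C \<times> {..<n}" for k
      using that gh coset_cocycle_mem by auto
    let ?p = "\<lambda>(c, i) y. of_bool (act y (coset_rep c) \<in> P i) / ?k"
    let ?q = "\<lambda>(c, j) y. of_bool (act y (coset_rep c) \<in> Q j) / ?k"
    show "0 \<le> ?p k y" "0 \<le> ?q k y" for k y by (auto split: prod.split)
    show "(\<Sum>k\<in>?C \<times> {..<m}. ?p k y) + (\<Sum>k\<in>?C \<times> {..<n}. ?q k y) \<le> 1" if "y \<in> X" for y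
    proof -
      let ?P = "\<lambda>c. \<Sum>i<m. of_bool (act y (coset_rep c) \<in> P i) :: real"
      let ?Q = "\<lambda>c. \<Sum>j<n. of_bool (act y (coset_rep c) \<in> Q j) :: real"
      have "(\<Sum>k\<in>?C \<times> {..<m}. ?p k y) + (\<Sum>k\<in>?C \<times> {..<n}. ?q k y)
        = (\<Sum>c\<in>?C. (?P c + ?Q c) / ?k)"
        by (simp add: sum.cartesian_product' sum_divide_distrib add_divide_distrib sum.distrib
            del: sum_of_bool_eq)
      also have "\<dots> \<le> (\<Sum>c\<in>?C. 1 / ?k)"
      proof (intro sum_mono divide_right_mono)
        fix c assume c: "c \<in> ?C"
        have "?P c + ?Q c \<le> of_bool (act y (coset_rep c) \<in> X)"
          using PQ disj
          by (intro finitely_additive.sum_measure_two_disjoint_families_le[OF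
                finitely_additive_point_mass]) auto
        then show "?P c + ?Q c \<le> 1" by (smt (verit) of_bool_less_eq_one)
      qed simp
      also have "\<dots> = 1" using card_rcosets_pos by simp
      finally show ?thesis .
    qed
    show "1 \<le> (\<Sum>k\<in>?C \<times> {..<m}. ?p k (act x (inv\<^bsub>G\<lparr>carrier := H\<rparr>\<^esub> ?\<sigma> k)))" if "x \<in> X" for x
      by (rule order_trans[OF coset_weights_cover[OF gh(1) that cov(1)]], intro eq_refl sum.cong)
        (use gh inv_H in auto)
    show "1 \<le> (\<Sum>k\<in>?C \<times> {..<n}. ?q k (act x (inv\<^bsub>G\<lparr>carrier := H\<rparr>\<^esub> ?\<tau> k)))" if "x \<in> X" for x
      by (rule order_trans[OF coset_weights_cover[OF gh(2) that cov(2)]], intro eq_refl sum.cong)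
        (use gh inv_H in auto)
  qed
  also have "\<dots> \<le> enat (Suc (card ?C * (m - 1)) + Suc (card ?C * (n - 1)))"
    using card_coset_cocycle_image[of m g'] card_coset_cocycle_image[of n h'] pos one
    by (simp add: add_mono)
  also have "Suc (card ?C * (m - 1)) + Suc (card ?C * (n - 1)) = 2 + card ?C * (m + n - 2)"
    using pos by (cases m; cases n) (auto simp: algebra_simps)
  finally show ?thesis .
qed

theorem tarski_number_finite_index:
  "tarski_number (G\<lparr>carrier := H\<rparr>) X act - 2
    \<le> enat (card (rcosets H)) * (tarski_number G X act - 2)"
proof (cases "tarski_number G X act = \<infinity>")
  case True
  \<comment> \<open>The index is positive, so the right-hand side is infinite as well.\<close>
  then show ?thesis using card_rcosets_pos by (simp add: enat_0_iff numeral_eq_enat)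
next
  case False
  then obtain m n P Q g h where dec: "paradoxical_decomposition G X act m n P Q g h"
    and T: "tarski_number G X act = enat (m + n)"
    by (rule tarski_number_attained)
  obtain t where t: "tarski_number (G\<lparr>carrier := H\<rparr>) X act = enat t"
    "t \<le> 2 + card (rcosets H) * (m + n - 2)"
    using tarski_number_subgroup_le[OF dec] by (metis enat_ile enat_ord_simps(1))
  then show ?thesis using T by (simp add: numeral_eq_enat)
qed

end

section \<open>Actions with amenable point stabilizers\<close>

text \<open>Preimages under an orbit map of the pieces decompose the group.\<close>

lemma group_tarski_number_le: "group_tarski_number G \<le> tarski_number G X act"
proof (rule tarski_number_greatest)
  fix m n P Q g h assume dec: "paradoxical_decomposition G X act m n P Q g h"
  interpret reg: right_group_action G "carrier G" "(\<otimes>)" by (rule right_regular_action)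
  obtain x where x: "x \<in> X" using nonempty by blast
  define D where "D R = {a \<in> carrier G. act x a \<in> R}" for R
  have cov: "\<forall>a\<in>carrier G. \<exists>i<l. a \<otimes> inv (k i) \<in> D (R i)"
    if k: "\<forall>i<l. k i \<in> carrier G" and c: "\<forall>x\<in>X. \<exists>i<l. act x (inv (k i)) \<in> R i"
    for l :: nat and R k
  proof
    fix a assume a: "a \<in> carrier G"
    obtain i where "i < l" "act (act x a) (inv (k i)) \<in> R i" using c act_closed[OF x a] by blast
    then show "\<exists>i<l. a \<otimes> inv (k i) \<in> D (R i)"
      using k a x by (intro exI[of _ i]) (simp add: D_def act_mult)
  qed
  have D: "D R \<subseteq> carrier G" "R \<inter> R' = {} \<Longrightarrow> D R \<inter> D R' = {}" for R R'
    by (auto simp: D_def)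
  have "paradoxical_decomposition G (carrier G) (\<otimes>) m n (\<lambda>i. D (P i)) (\<lambda>j. D (Q j)) g h"
    using dec cov[of m g P] cov[of n h Q]
    unfolding paradoxical_decomposition_iff reg.paradoxical_decomposition_iff disjoint_family_on_def
    by (simp add: D)
  then show "group_tarski_number G \<le> enat (m + n)"
    unfolding group_tarski_number_def by (rule tarski_number_le)
qed

lemma orbit_representatives:
  obtains r e where "\<And>y. y \<in> X \<Longrightarrow> r y \<in> X" "\<And>y. y \<in> X \<Longrightarrow> e y \<in> carrier G"
    "\<And>y. y \<in> X \<Longrightarrow> act (r y) (e y) = y"
    "\<And>y a. y \<in> X \<Longrightarrow> a \<in> carrier G \<Longrightarrow> r (act y a) = r y"
proof -
  define orb where "orb y = act y ` carrier G" for y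
  define r where "r y = (SOME z. z \<in> orb y)" for y
  have orb_act: "orb (act y a) = orb y" if y: "y \<in> X" and a: "a \<in> carrier G" for y a
  proof -
    have "act (act y a) b \<in> orb y" if "b \<in> carrier G" for b
      using act_mult[OF y a that] a that unfolding orb_def by (metis imageI m_closed)
    moreover have "act y b \<in> orb (act y a)" if b: "b \<in> carrier G" for b
    proof -
      have "act (act y a) (inv a \<otimes> b) = act y b"
        using y a b by (simp add: act_mult act_closed act_act_inv)
      then show ?thesis using a b unfolding orb_def by (metis imageI inv_closed m_closed)
    qed
    ultimately show ?thesis by (auto simp: orb_def)
  qed
  have "\<exists>a\<in>carrier G. r y = act y a" for y
  proof -
    have "r y \<in> orb y" unfolding r_def by (rule someI_ex) (auto simp: orb_def)
    then show ?thesis by (auto simp: orb_def)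
  qed
  then obtain a where a: "\<And>y. a y \<in> carrier G" "\<And>y. r y = act y (a y)" by metis
  show thesis
  proof (rule that)
    show "r y \<in> X" "inv (a y) \<in> carrier G" "act (r y) (inv (a y)) = y" if "y \<in> X" for y
      using a[of y] that act_closed act_act_inv by auto
    show "r (act y b) = r y" if "y \<in> X" "b \<in> carrier G" for y b
      using orb_act[OF that] by (simp add: r_def)
  qed
qed

text \<open>
  The elements carrying \<open>z\<close> to \<open>y\<close> form a right coset of the stabilizer of \<open>z\<close>, so an invariant
  mean on the stabilizer transports to a mean on this coset, by invariance the same for all
  representatives \<open>e\<close>. The weight of a piece \<open>P i\<close> at \<open>y\<close> is its mean there. Translation
  by \<open>g i\<close> carries the means on these cosets into each other, so a cover of the group gives total
  weight at least 1.
\<close>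

lemma mean_weights_cover:
  fixes m :: nat
  assumes z: "z \<in> X" and x: "x \<in> X"
    and e: "\<And>y. y \<in> X \<Longrightarrow> e y \<in> carrier G"
    and ex: "act z (e x) = x" and ey: "\<And>i. i < m \<Longrightarrow> act z (e (act x (inv (g i)))) = act x (inv (g i))"
    and g: "\<forall>i<m. g i \<in> carrier G"
    and cov: "\<forall>a\<in>carrier G. \<exists>i<m. a \<otimes> inv (g i) \<in> P i"
    and K: "K = {k \<in> carrier G. act z k = z}"
    and fa: "finitely_additive K \<mu>" and one: "\<mu> K = 1"
    and inv: "\<And>A k. A \<subseteq> K \<Longrightarrow> k \<in> K \<Longrightarrow> \<mu> (A #> k) = \<mu> A"
  shows "1 \<le> (\<Sum>i<m. \<mu> {k \<in> K. k \<otimes> e (act x (inv (g i))) \<in> P i})"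
proof -
  define y where "y i = act x (inv (g i))" for i
  define A where "A i = {k \<in> K. k \<otimes> e (y i) \<in> P i}" for i
  \<comment> \<open>Translation by \<open>g i\<close>, read in the stabilizer through the base points \<open>e (y i)\<close> and \<open>e x\<close>.\<close>
  define k where "k i = e (y i) \<otimes> g i \<otimes> inv (e x)" for i
  have yX: "y i \<in> X" if "i < m" for i using that g x act_closed by (auto simp: y_def)
  have kK: "k i \<in> K" if i: "i < m" for i
  proof -
    have "act z (k i) = act (act (act z (e (y i))) (g i)) (inv (e x))"
      using z x e[OF x] e[OF yX[OF i]] g i by (simp add: k_def act_mult act_closed)
    also have "\<dots> = act x (inv (e x))" using ey[OF i] g i x by (simp add: y_def act_inv_act)
    also have "\<dots> = z" using act_act_inv[OF z e[OF x]] ex by simp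
    finally show ?thesis using K e[OF x] e[OF yX[OF i]] g i by (simp add: k_def)
  qed
  have sub: "subgroup K G"
    unfolding K
  proof (rule subgroupI)
    show "{k \<in> carrier G. act z k = z} \<noteq> {}" using z act_one by blast
    show "inv a \<in> {k \<in> carrier G. act z k = z}" if "a \<in> {k \<in> carrier G. act z k = z}" for a
      using that z act_act_inv[of z a] by auto
  qed (use z act_mult in auto)
  have "l \<in> (\<Union>i<m. A i #> k i)" if l: "l \<in> K" for l
  proof -
    have lG: "l \<in> carrier G" using l K by auto
    obtain i where i: "i < m" "l \<otimes> e x \<otimes> inv (g i) \<in> P i"
      using cov lG e[OF x] by blast
    have kG: "k i \<in> carrier G" using kK[OF i(1)] K by auto
    have "l \<otimes> inv (k i) \<otimes> e (y i) = l \<otimes> e x \<otimes> inv (g i)"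
      using lG e[OF x] e[OF yX[OF i(1)]] g i(1)
      by (simp add: k_def inv_mult_group m_assoc)
    moreover have "l \<otimes> inv (k i) \<in> K"
      using sub l kK[OF i(1)] by (simp add: subgroup.m_closed subgroup.m_inv_closed)
    ultimately have "l \<otimes> inv (k i) \<in> A i" using i by (simp add: A_def)
    moreover have "l = l \<otimes> inv (k i) \<otimes> k i" using lG kG by (simp add: m_assoc)
    ultimately show ?thesis using i(1) by (auto simp: r_coset_def)
  qed
  moreover have Ak: "A i #> k i \<subseteq> K" if "i < m" for i
    using kK[OF that] sub by (auto simp: A_def r_coset_def subgroup.m_closed)
  ultimately have "K = (\<Union>i<m. A i #> k i)" by blast
  then have "1 = \<mu> (\<Union>i<m. A i #> k i)" using one by simp
  also have "\<dots> \<le> (\<Sum>i<m. \<mu> (A i #> k i))"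
    using Ak by (intro finitely_additive.measure_UN_le[OF fa]) auto
  also have "\<dots> = (\<Sum>i<m. \<mu> (A i))" using inv kK by (intro sum.cong) (auto simp: A_def)
  finally show ?thesis by (simp add: A_def y_def)
qed

lemma invariant_mean_of_amenable:
  assumes "amenable_group (G\<lparr>carrier := K\<rparr>)"
  shows "\<exists>\<mu>. finitely_additive K \<mu> \<and> \<mu> K = 1 \<and>
    (\<forall>A k. A \<subseteq> K \<longrightarrow> k \<in> K \<longrightarrow> \<mu> (A #> k) = \<mu> A)"
proof -
  have translate: "A #>\<^bsub>G\<lparr>carrier := K\<rparr>\<^esub> k = A #> k" for A k by (simp add: r_coset_def)
  obtain \<mu> :: "'a set \<Rightarrow> real" where \<mu>: "\<forall>A. A \<subseteq> K \<longrightarrow> 0 \<le> \<mu> A" "\<mu> K = 1"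
    "\<forall>A B. A \<subseteq> K \<longrightarrow> B \<subseteq> K \<longrightarrow> A \<inter> B = {} \<longrightarrow> \<mu> (A \<union> B) = \<mu> A + \<mu> B"
    "\<forall>A k. A \<subseteq> K \<longrightarrow> k \<in> K \<longrightarrow> \<mu> (A #> k) = \<mu> A"
    using assms unfolding amenable_group_def translate by (elim conjE exE) simp
  have "finitely_additive K \<mu>" by unfold_locales (use \<mu> in simp_all)
  with \<mu>(2,4) show ?thesis by (intro exI[of _ \<mu>] conjI)
qed

text \<open>
  All points of an orbit must use the same stabilizer and the same mean, as weights at
  different points of the orbit are compared in a cover; hence the choice of one representative
  \<open>r y\<close> for each orbit.
\<close>

lemma tarski_number_le_group:
  assumes amenable: "\<forall>x\<in>X. amenable_group (point_stabilizer G act x)"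
  shows "tarski_number G X act \<le> group_tarski_number G"
  unfolding group_tarski_number_def
proof (rule tarski_number_greatest)
  fix m n P Q g h assume dec: "paradoxical_decomposition G (carrier G) (\<otimes>) m n P Q g h"
  then have gh: "\<forall>i<m. g i \<in> carrier G" "\<forall>j<n. h j \<in> carrier G"
    and disj: "disjoint_family_on P {..<m}" "disjoint_family_on Q {..<n}"
      "\<forall>i<m. \<forall>j<n. P i \<inter> Q j = {}"
    and cov: "\<forall>a\<in>carrier G. \<exists>i<m. a \<otimes> inv (g i) \<in> P i" "\<forall>a\<in>carrier G. \<exists>j<n. a \<otimes> inv (h j) \<in> Q j"
    unfolding right_group_action.paradoxical_decomposition_iff[OF right_regular_action] by blast+
  define K where "K z = {k \<in> carrier G. act z k = z}" for z
  define mean where "mean z \<mu> \<longleftrightarrow> finitely_additive (K z) \<mu> \<and> \<mu> (K z) = 1 \<and>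
      (\<forall>A k. A \<subseteq> K z \<longrightarrow> k \<in> K z \<longrightarrow> \<mu> (A #> k) = \<mu> A)" for z \<mu>
  have "\<exists>\<mu>. mean z \<mu>" if "z \<in> X" for z
  proof -
    have "amenable_group (G\<lparr>carrier := K z\<rparr>)"
      using amenable \<open>z \<in> X\<close> by (simp add: point_stabilizer_def stabilizer_def K_def)
    then show ?thesis unfolding mean_def by (rule invariant_mean_of_amenable)
  qed
  then obtain \<mu> where "\<And>z. z \<in> X \<Longrightarrow> mean z (\<mu> z)" by metis
  then have \<mu>: "\<And>z. z \<in> X \<Longrightarrow> finitely_additive (K z) (\<mu> z)"
      "\<And>z. z \<in> X \<Longrightarrow> \<mu> z (K z) = 1"
      "\<And>z A k. z \<in> X \<Longrightarrow> A \<subseteq> K z \<Longrightarrow> k \<in> K z \<Longrightarrow> \<mu> z (A #> k) = \<mu> z A"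
    by (simp_all add: mean_def)
  obtain r e where r: "\<And>y. y \<in> X \<Longrightarrow> r y \<in> X" and e: "\<And>y. y \<in> X \<Longrightarrow> e y \<in> carrier G"
    and re: "\<And>y. y \<in> X \<Longrightarrow> act (r y) (e y) = y"
    and r_act: "\<And>y a. y \<in> X \<Longrightarrow> a \<in> carrier G \<Longrightarrow> r (act y a) = r y"
    using orbit_representatives by blast
  define w where "w R y = \<mu> (r y) {k \<in> K (r y). k \<otimes> e y \<in> R}" for R y
  have w_nonneg: "0 \<le> w R y" if "y \<in> X" for R y
    unfolding w_def using finitely_additive.nonneg[OF \<mu>(1)[OF r[OF that]]] by auto
  have w_cover: "1 \<le> (\<Sum>i<l. w (R i) (act x (inv (k i))))"
    if k: "\<forall>i<l. k i \<in> carrier G" and c: "\<forall>a\<in>carrier G. \<exists>i<l. a \<otimes> inv (k i) \<in> R i"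
      and x: "x \<in> X" for l :: nat and k R x
  proof -
    have rk: "r (act x (inv (k i))) = r x" if "i < l" for i using r_act x k that by auto
    have "1 \<le> (\<Sum>i<l. \<mu> (r x) {a \<in> K (r x). a \<otimes> e (act x (inv (k i))) \<in> R i})"
    proof (rule mean_weights_cover[where z = "r x" and x = x and e = e and g = k and P = R
          and K = "K (r x)"])
      show "act (r x) (e (act x (inv (k i)))) = act x (inv (k i))" if "i < l" for i
        using re[of "act x (inv (k i))"] rk[OF that] x k that act_closed by auto
      show "K (r x) = {k \<in> carrier G. act (r x) k = r x}" by (simp add: K_def)
    qed (use r x e re k c \<mu> in auto)
    then show ?thesis using rk by (simp add: w_def)
  qed
  have "tarski_number G X act \<le> enat (card (g ` {..<m}) + card (h ` {..<n}))"
  proof (rule tarski_number_le_of_fractional_decomposition)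
    show "(\<Sum>i<m. w (P i) y) + (\<Sum>j<n. w (Q j) y) \<le> 1" if y: "y \<in> X" for y
    proof -
      have "(\<Sum>i<m. w (P i) y) + (\<Sum>j<n. w (Q j) y) \<le> \<mu> (r y) (K (r y))"
        unfolding w_def using disj
        by (intro finitely_additive.sum_measure_two_disjoint_families_le[OF \<mu>(1)[OF r[OF y]]])
          (fastforce simp: disjoint_family_on_def)+
      then show ?thesis using \<mu>(2)[OF r[OF y]] by simp
    qed
    show "1 \<le> (\<Sum>i<m. w (P i) (act x (inv (g i))))" if "x \<in> X" for x
      using w_cover[OF gh(1) cov(1) that] .
    show "1 \<le> (\<Sum>j<n. w (Q j) (act x (inv (h j))))" if "x \<in> X" for x
      using w_cover[OF gh(2) cov(2) that] .
  qed (use gh w_nonneg in auto)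
  also have "\<dots> \<le> enat (m + n)"
    using card_image_le[of "{..<m}" g] card_image_le[of "{..<n}" h] by simp
  finally show "tarski_number G X act \<le> enat (m + n)" .
qed

end

theorem theorem1p3:
  fixes G :: "('g, 'b) monoid_scheme" and X :: "'x set" and act :: "'x \<Rightarrow> 'g \<Rightarrow> 'x"
  assumes "right_group_action G X act"
  shows "(\<forall>H. subgroup H G \<and> finite (rcosets\<^bsub>G\<^esub> H) \<longrightarrow>
            tarski_number (G\<lparr>carrier := H\<rparr>) X act - 2
              \<le> enat (card (rcosets\<^bsub>G\<^esub> H)) * (tarski_number G X act - 2)) \<and>
         ((\<forall>x\<in>X. amenable_group (point_stabilizer G act x)) \<longrightarrow>
            tarski_number G X act = group_tarski_number G)"
  using right_group_action.tarski_number_finite_index[OF assms]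
    right_group_action.tarski_number_le_group[OF assms]
    right_group_action.group_tarski_number_le[OF assms]
  by (blast intro: order_antisym)

end
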